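(* Let $k:\mathcal{Z}\times\mathcal{Z}\to\mathbb{R}$ be the reproducing kernel of an RKHS $\mathcal{H}$, let $X_1,\dots,X_n,Y_1,\dots,Y_m\in\mathcal{Z}$, let $\lambda>0$, and assume the Gram matrix $K_{11}=(k(X_i,X_{i'}))_{i,i'=1}^n$ is positive definite. For $\alpha\in\mathbb{R}^n$ put $$w_\alpha=\sum_{i=1}^n\alpha_i k(\cdot,X_i)+\frac{1}{m\lambda}\sum_{j=1}^m k(\cdot,Y_j)\in\mathcal{H}.$$ Let $H_{\mathrm{KuLSIF}}$ and $H_{\mathrm{KMM}}$ denote the Hessian matrices with respect to $\alpha\in\mathbb{R}^n$ of, respectively, the functions $$\alpha\mapsto \frac{1}{2n}\sum_{i=1}^n w_\alpha(X_i)^2-\frac1m\sum_{j=1}^m w_\alpha(Y_j)+\frac{\lambda}{2}\|w_\alpha\|_{\mathcal{H}}^2,\qquad \alpha\mapsto\frac12\big\|\widehat\Phi(w_\alpha)+\lambda w_\alpha\big\|_{\mathcal{H}}^2,$$ where $\widehat\Phi(w)=\frac1n\sum_{i=1}^n w(X_i)k(\cdot,X_i)-\frac1m\sum_{j=1}^m k(\cdot,Y_j)$. Then $$H_{\mathrm{KuLSIF}}=\frac1nK_{11}^2+\lambda K_{11},\qquad H_{\mathrm{KMM}}=\frac1{n^2}K_{11}^3+\frac{2\lambda}{n}K_{11}^2+\lambda^2K_{11},$$ $$\kappa(H_{\mathrm{KuLSIF}})=\kappa(K_{11})\,\kappa\big(\tfrac1nK_{11}+\lambda I_n\big),\qquad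 \kappa(H_{\mathrm{KMM}})=\kappa(K_{11})\,\kappa\big(\tfrac1nK_{11}+\lambda I_n\big)^2,$$ and consequently $\kappa(H_{\mathrm{KuLSIF}})\le\kappa(H_{\mathrm{KMM}})$.
   Context: For a symmetric positive definite matrix $A$, $\kappa(A)=\lambda_{\max}(A)/\lambda_{\min}(A)$ is the ratio of its largest to its smallest eigenvalue. $I_n$ is the $n\times n$ identity matrix. The first objective is that of KuLSIF (kernel unconstrained least-squares importance fitting) and the second that of the inductive variant of KMM (kernel mean matching), both restricted to functions of the form $w_\alpha$. *)

theory Defs
  imports "HOL-Analysis.Analysis"
begin

section \<open>Reproducing kernel Hilbert spaces\<close>

text \<open>
  A Hilbert space of real functions is given by its carrier \<open>H\<close> together with its inner product
  \<open>ip\<close>, about which nothing is assumed outside \<open>H\<close>. The vector space operations are pointwise.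
\<close>

definition ip_norm :: "(('z \<Rightarrow> real) \<Rightarrow> ('z \<Rightarrow> real) \<Rightarrow> real) \<Rightarrow> ('z \<Rightarrow> real) \<Rightarrow> real"
  where "ip_norm ip f = sqrt (ip f f)"

locale function_hilbert_space =
  fixes H :: "('z \<Rightarrow> real) set"
    and ip :: "('z \<Rightarrow> real) \<Rightarrow> ('z \<Rightarrow> real) \<Rightarrow> real"
  assumes zero_mem: "(\<lambda>z. 0) \<in> H"
    and add_mem: "f \<in> H \<Longrightarrow> g \<in> H \<Longrightarrow> (\<lambda>z. f z + g z) \<in> H"
    and scale_mem: "f \<in> H \<Longrightarrow> (\<lambda>z. c * f z) \<in> H"
    and ip_commute: "f \<in> H \<Longrightarrow> g \<in> H \<Longrightarrow> ip f g = ip g f"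
    and ip_add_left: "f \<in> H \<Longrightarrow> g \<in> H \<Longrightarrow> h \<in> H \<Longrightarrow> ip (\<lambda>z. f z + g z) h = ip f h + ip g h"
    and ip_scale_left: "f \<in> H \<Longrightarrow> g \<in> H \<Longrightarrow> ip (\<lambda>z. c * f z) g = c * ip f g"
    and ip_pos: "f \<in> H \<Longrightarrow> f \<noteq> (\<lambda>z. 0) \<Longrightarrow> 0 < ip f f"
    and complete:
      "(\<And>n. F n \<in> H) \<Longrightarrow>
       (\<And>e. 0 < e \<Longrightarrow> \<exists>N. \<forall>m\<ge>N. \<forall>n\<ge>N. ip_norm ip (\<lambda>z. F m z - F n z) < e) \<Longrightarrow>
       \<exists>f\<in>H. (\<lambda>n. ip_norm ip (\<lambda>z. F n z - f z)) \<longlonglongrightarrow> 0"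

locale rkhs = function_hilbert_space H ip
  for H :: "('z \<Rightarrow> real) set"
    and ip :: "('z \<Rightarrow> real) \<Rightarrow> ('z \<Rightarrow> real) \<Rightarrow> real" +
  fixes k :: "'z \<Rightarrow> 'z \<Rightarrow> real"
  assumes kernel_mem: "(\<lambda>z. k z x) \<in> H"
    and reproducing: "f \<in> H \<Longrightarrow> ip f (\<lambda>z. k z x) = f x"


section \<open>Matrices\<close>

definition positive_definite :: "real^'n^'n \<Rightarrow> bool"
  where "positive_definite A \<longleftrightarrow> transpose A = A \<and> (\<forall>v. v \<noteq> 0 \<longrightarrow> 0 < v \<bullet> (A *v v))"

definition eigenvalues :: "real^'n^'n \<Rightarrow> real set"
  where "eigenvalues A = {c. \<exists>v. v \<noteq> 0 \<and> A *v v = c *\<^sub>R v}"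

text \<open>Meaningful for symmetric positive definite matrices, whose set of eigenvalues is finite and
  nonempty.\<close>

definition cond_number :: "real^'n^'n \<Rightarrow> real"
  where "cond_number A = Max (eigenvalues A) / Min (eigenvalues A)"


section \<open>Hessians\<close>

definition has_hessian :: "(real^'n \<Rightarrow> real) \<Rightarrow> real^'n^'n \<Rightarrow> real^'n \<Rightarrow> bool"
  where "has_hessian f A x \<longleftrightarrow>
    (\<exists>g. (\<forall>\<^sub>F y in nhds x. GDERIV f y :> g y) \<and> (g has_derivative (\<lambda>h. A *v h)) (at x))"

definition hessian :: "(real^'n \<Rightarrow> real) \<Rightarrow> real^'n \<Rightarrow> real^'n^'n"
  where "hessian f x = (THE A. has_hessian f A x)"

lemma has_hessian_unique:
  assumes "has_hessian f A x" and "has_hessian f B x"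
  shows "A = B"
proof -
  obtain g where g: "\<forall>\<^sub>F y in nhds x. GDERIV f y :> g y" "(g has_derivative (\<lambda>h. A *v h)) (at x)"
    using assms(1) unfolding has_hessian_def by blast
  obtain g' where g': "\<forall>\<^sub>F y in nhds x. GDERIV f y :> g' y" "(g' has_derivative (\<lambda>h. B *v h)) (at x)"
    using assms(2) unfolding has_hessian_def by blast
  have "u = v" if "GDERIV f y :> u" "GDERIV f y :> v" for u v y
  proof -
    have "(\<lambda>h. h \<bullet> u) = (\<lambda>h. h \<bullet> v)"
      using that unfolding gderiv_def by (rule has_derivative_unique)
    then have "(u - v) \<bullet> u = (u - v) \<bullet> v" by metis
    then have "(u - v) \<bullet> (u - v) = 0" by (simp add: inner_diff_right)
    then show ?thesis by simp
  qed
  then have ev: "\<forall>\<^sub>F y in nhds x. g' y = g y"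
    using eventually_conj[OF g(1) g'(1)] by (auto elim!: eventually_mono)
  then have "\<forall>\<^sub>F y in at x. g' y = g y" and "g' x = g x"
    by (auto simp: eventually_nhds_conv_at)
  with g'(2) have "(g has_derivative (\<lambda>h. B *v h)) (at x)"
    by (auto intro: has_derivative_transform_eventually)
  with g(2) have "(\<lambda>h. A *v h) = (\<lambda>h. B *v h)" by (rule has_derivative_unique)
  then show ?thesis by (simp add: matrix_eq fun_eq_iff)
qed

lemma hessian_eqI: "has_hessian f A x \<Longrightarrow> hessian f x = A"
  unfolding hessian_def using has_hessian_unique by (blast intro: the_equality)


section \<open>The KuLSIF and KMM objectives\<close>

text \<open>The sample sizes are \<open>n = CARD('n)\<close> and \<open>m = CARD('m)\<close>.\<close>

definition gram :: "('z \<Rightarrow> 'z \<Rightarrow> real) \<Rightarrow> ('n \<Rightarrow> 'z) \<Rightarrow> real^'n^'n"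
  where "gram k X = (\<chi> i i'. k (X i) (X i'))"

definition w_fun ::
  "('z \<Rightarrow> 'z \<Rightarrow> real) \<Rightarrow> ('n::finite \<Rightarrow> 'z) \<Rightarrow> ('m::finite \<Rightarrow> 'z) \<Rightarrow> real \<Rightarrow> real^'n \<Rightarrow> 'z \<Rightarrow> real"
  where "w_fun k X Y reg \<alpha> =
    (\<lambda>z. (\<Sum>i\<in>UNIV. \<alpha> $ i * k z (X i)) + 1 / (real CARD('m) * reg) * (\<Sum>j\<in>UNIV. k z (Y j)))"

definition Phi_hat ::
  "('z \<Rightarrow> 'z \<Rightarrow> real) \<Rightarrow> ('n::finite \<Rightarrow> 'z) \<Rightarrow> ('m::finite \<Rightarrow> 'z) \<Rightarrow> ('z \<Rightarrow> real) \<Rightarrow> 'z \<Rightarrow> real"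
  where "Phi_hat k X Y w =
    (\<lambda>z. 1 / real CARD('n) * (\<Sum>i\<in>UNIV. w (X i) * k z (X i)) - 1 / real CARD('m) * (\<Sum>j\<in>UNIV. k z (Y j)))"

definition KuLSIF_objective ::
  "(('z \<Rightarrow> real) \<Rightarrow> ('z \<Rightarrow> real) \<Rightarrow> real) \<Rightarrow> ('n::finite \<Rightarrow> 'z) \<Rightarrow> ('m::finite \<Rightarrow> 'z) \<Rightarrow> real
    \<Rightarrow> ('z \<Rightarrow> real) \<Rightarrow> real"
  where "KuLSIF_objective ip X Y reg w =
    1 / (2 * real CARD('n)) * (\<Sum>i\<in>UNIV. (w (X i))\<^sup>2) - 1 / real CARD('m) * (\<Sum>j\<in>UNIV. w (Y j))
      + reg / 2 * (ip_norm ip w)\<^sup>2"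

definition KMM_objective ::
  "(('z \<Rightarrow> real) \<Rightarrow> ('z \<Rightarrow> real) \<Rightarrow> real) \<Rightarrow> ('z \<Rightarrow> 'z \<Rightarrow> real) \<Rightarrow> ('n::finite \<Rightarrow> 'z)
    \<Rightarrow> ('m::finite \<Rightarrow> 'z) \<Rightarrow> real \<Rightarrow> ('z \<Rightarrow> real) \<Rightarrow> real"
  where "KMM_objective ip k X Y reg w =
    1 / 2 * (ip_norm ip (\<lambda>z. Phi_hat k X Y w z + reg * w z))\<^sup>2"

end

theory Submission
  imports Defs
begin

text \<open>By the reproducing property both objectives are quadratic in \<open>\<alpha>\<close>, with Hessians \<open>f K\<close> for
  the polynomials \<open>f t = t (t/n + \<lambda>)\<close> and \<open>f t = t (t/n + \<lambda>)\<^sup>2\<close>. The eigenvalues of \<open>f K\<close> are the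
  images under \<open>f\<close> of those of \<open>K\<close>, and \<open>f\<close> is increasing on the positive reals, so the extreme
  eigenvalues of \<open>f K\<close> come from the extreme eigenvalues of \<open>K\<close> and the condition numbers factor.\<close>

section \<open>Eigenvalues of symmetric matrices\<close>

text \<open>Turns a matrix polynomial applied to a vector into nested applications, so that
  polynomial identities in \<open>K\<close> become vector algebra.\<close>

lemmas matrix_polynomial_simps = matrix_vector_mul_assoc[symmetric] scaleR_matrix_vector_assoc[symmetric]
  algebra_simps

lemma symmetric_inner_matrix:
  fixes A :: "real^'n^'n"
  assumes "transpose A = A"
  shows "v \<bullet> (A *v w) = (A *v v) \<bullet> w"
  using dot_lmul_matrix[of v A w] vector_transpose_matrix[of v A] assms by simp

text \<open>A maximiser \<open>u\<close> of the Rayleigh quotient over the unit sphere of \<open>E\<close> is an eigenvector: moving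
  from \<open>u\<close> along the residual \<open>M u - A u\<close>, which lies in \<open>E\<close>, would otherwise increase the quotient.\<close>

lemma symmetric_invariant_subspace_eigenvector:
  fixes A :: "real^'n^'n"
  assumes sym: "transpose A = A" and E: "subspace E" and inv: "\<And>v. v \<in> E \<Longrightarrow> A *v v \<in> E"
    and "w \<in> E" and "w \<noteq> 0"
  obtains c v where "v \<in> E" and "v \<noteq> 0" and "A *v v = c *\<^sub>R v"
proof -
  let ?S = "sphere 0 1 \<inter> E"
  have "compact ?S"
    using E by (intro compact_Int_closed closed_subspace) auto
  moreover have "(1 / norm w) *\<^sub>R w \<in> ?S"
    using \<open>w \<in> E\<close> \<open>w \<noteq> 0\<close> E by (auto simp: subspace_scale)
  moreover have "continuous_on ?S (\<lambda>v. v \<bullet> (A *v v))"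
    by (intro continuous_intros)
  ultimately obtain u where u: "u \<in> ?S" and max: "\<And>v. v \<in> ?S \<Longrightarrow> v \<bullet> (A *v v) \<le> u \<bullet> (A *v u)"
    using continuous_attains_sup[of ?S "\<lambda>v. v \<bullet> (A *v v)"] by blast
  define M where "M = u \<bullet> (A *v u)"
  \<comment> \<open>\<open>Q v\<close> is the gap between the Rayleigh quotient of \<open>v\<close>
    and its maximum \<open>M\<close>, multiplied by \<open>v \<bullet> v\<close>. It is nonnegative
    on \<open>E\<close> by homogeneity and vanishes at \<open>u\<close>.\<close>
  define Q where "Q v = M * (v \<bullet> v) - v \<bullet> (A *v v)" for v
  define r where "r = M *\<^sub>R u - A *v u"
  have uE: "u \<in> E" and uu: "u \<bullet> u = 1"
    using u by (auto simp: norm_eq_1)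
  have rE: "r \<in> E"
    unfolding r_def using E uE inv by (simp add: subspace_diff subspace_scale)
  have Q_nonneg: "0 \<le> Q v" if "v \<in> E" for v
  proof (cases "v = 0")
    case False
    have "(1 / norm v) *\<^sub>R v \<in> ?S"
      using that False E by (auto simp: subspace_scale)
    from max[OF this] have "(v \<bullet> (A *v v)) / (v \<bullet> v) \<le> M"
      by (simp add: M_def matrix_vector_mult_scaleR power2_norm_eq_inner flip: power2_eq_square)
    moreover have "0 < v \<bullet> v"
      using False by simp
    ultimately show ?thesis
      by (simp add: Q_def field_simps)
  qed (simp add: Q_def)
  \<comment> \<open>A parabola in \<open>s\<close> without constant term; its slope at
    \<open>0\<close> is \<open>-2 * (r \<bullet> r)\<close> because half the gradient of
    \<open>Q\<close> at \<open>u\<close> is \<open>r\<close>.\<close>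
  have "Q (u - s *\<^sub>R r) = s\<^sup>2 * Q r - 2 * s * (r \<bullet> r)" for s
  proof -
    have "r \<bullet> (A *v u) = u \<bullet> (A *v r)"
      using symmetric_inner_matrix[OF sym, of r u] by (simp add: inner_commute)
    then have "Q (u - s *\<^sub>R r) = Q u - 2 * s * (M * (r \<bullet> u) - r \<bullet> (A *v u)) + s\<^sup>2 * Q r"
      unfolding Q_def
      by (simp add: matrix_vector_mult_diff_distrib matrix_vector_mult_scaleR inner_diff_left
          inner_diff_right inner_commute[of u r] algebra_simps power2_eq_square)
    moreover have "M * (r \<bullet> u) - r \<bullet> (A *v u) = r \<bullet> r"
      by (subst (4) r_def) (simp add: inner_diff_right)
    moreover have "Q u = 0"
      by (simp add: Q_def M_def uu)
    ultimately show ?thesis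
      by simp
  qed
  moreover have "0 \<le> Q (u - s *\<^sub>R r)" for s
    using E uE rE by (intro Q_nonneg) (simp add: subspace_diff subspace_scale)
  ultimately have quad: "2 * s * (r \<bullet> r) \<le> s\<^sup>2 * Q r" for s
    by (metis diff_ge_0_iff_ge)
  have "r \<bullet> r = 0"
  proof (cases "Q r = 0")
    case True
    then show ?thesis
      using quad[of 1] inner_ge_zero[of r] by simp
  next
    case False
    then have "0 < Q r"
      using Q_nonneg[OF rE] by simp
    \<comment> \<open>This \<open>s\<close> minimises the parabola. The minimum is minus the square
      of \<open>r \<bullet> r\<close> divided by \<open>Q r\<close>, so it is nonnegative only for
      \<open>r = 0\<close>.\<close>
    with quad[of "(r \<bullet> r) / Q r"] show ?thesis
      by (simp add: power2_eq_square field_simps)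
        (smt (verit) mult_nonneg_nonneg mult_eq_0_iff inner_eq_zero_iff inner_ge_zero)
  qed
  then have "A *v u = M *\<^sub>R u"
    by (simp add: r_def)
  then show thesis
    using that uE uu by fastforce
qed

text \<open>The whole space is invariant; \<open>axis undefined 1\<close> merely serves as some
  nonzero vector in it.\<close>

lemma symmetric_eigenvalues_nonempty:
  fixes A :: "real^'n^'n"
  assumes "transpose A = A"
  shows "eigenvalues A \<noteq> {}"
proof -
  obtain c v where "v \<noteq> 0" "A *v v = c *\<^sub>R v"
    using symmetric_invariant_subspace_eigenvector[OF assms subspace_UNIV, of "axis undefined 1"]
    by (metis UNIV_I axis_eq_0_iff zero_neq_one)
  then show ?thesis
    by (auto simp: eigenvalues_def)
qed

text \<open>Eigenvectors for distinct eigenvalues are orthogonal, so choosing one per eigenvalue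
  gives an independent set, which is finite in finite dimension.\<close>

lemma symmetric_eigenvalues_finite:
  fixes A :: "real^'n^'n"
  assumes sym: "transpose A = A"
  shows "finite (eigenvalues A)"
proof -
  obtain f where f: "\<And>c. c \<in> eigenvalues A \<Longrightarrow> f c \<noteq> 0 \<and> A *v f c = c *\<^sub>R f c"
    using bchoice[of "eigenvalues A" "\<lambda>c v. v \<noteq> 0 \<and> A *v v = c *\<^sub>R v"]
    by (auto simp: eigenvalues_def)
  have inj: "inj_on f (eigenvalues A)"
    by (rule inj_onI) (metis f scaleR_cancel_right)
  have "orthogonal (f c) (f d)" if "c \<in> eigenvalues A" "d \<in> eigenvalues A" "c \<noteq> d" for c d
  proof -
    have "d * (f c \<bullet> f d) = c * (f c \<bullet> f d)"
      using symmetric_inner_matrix[OF sym, of "f c" "f d"] f that by simp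
    then show ?thesis
      using that by (simp add: orthogonal_def)
  qed
  then have "pairwise orthogonal (f ` eigenvalues A)"
    by (auto simp: pairwise_def)
  moreover have "0 \<notin> f ` eigenvalues A"
    using f by force
  ultimately have "finite (f ` eigenvalues A)"
    using pairwise_orthogonal_independent independent_bound by blast
  then show ?thesis
    using inj by (rule finite_imageD)
qed

text \<open>An eigenspace of \<open>B\<close> is invariant under \<open>A\<close>, so it contains an eigenvector of \<open>A\<close>.\<close>

lemma eigenvalues_commuting_image:
  fixes A B :: "real^'n^'n"
  assumes sym: "transpose A = A" and comm: "A ** B = B ** A"
    and p: "\<And>c v. A *v v = c *\<^sub>R v \<Longrightarrow> B *v v = p c *\<^sub>R v"
  shows "eigenvalues B = p ` eigenvalues A"
proof (rule set_eqI, rule iffI)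
  fix d
  assume "d \<in> eigenvalues B"
  then obtain w where w: "w \<noteq> 0" "B *v w = d *\<^sub>R w"
    by (auto simp: eigenvalues_def)
  let ?E = "{v. B *v v = d *\<^sub>R v}"
  have sub: "subspace ?E"
    by (auto simp: subspace_def matrix_vector_right_distrib matrix_vector_mult_scaleR
        scaleR_add_right scaleR_left_commute)
  have inv: "A *v v \<in> ?E" if "v \<in> ?E" for v
    using that comm by (simp add: matrix_vector_mul_assoc)
      (metis comm matrix_vector_mul_assoc matrix_vector_mult_scaleR)
  obtain c v where "v \<in> ?E" and v: "v \<noteq> 0" "A *v v = c *\<^sub>R v"
    using symmetric_invariant_subspace_eigenvector[OF sym sub inv] w by blast
  then have "p c *\<^sub>R v = d *\<^sub>R v"
    using p[OF v(2)] by simp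
  then show "d \<in> p ` eigenvalues A"
    using v by (auto simp: eigenvalues_def)
next
  fix d
  assume "d \<in> p ` eigenvalues A"
  then obtain c v where "d = p c" "v \<noteq> 0" "A *v v = c *\<^sub>R v"
    by (auto simp: eigenvalues_def)
  with p[of v c] show "d \<in> eigenvalues B"
    unfolding eigenvalues_def by blast
qed

text \<open>Commutation and the action on eigenvectors together express that \<open>B\<close> is
  \<open>p\<close> applied to \<open>A\<close>. Monotonicity is asked only on the spectrum, since
  the Hessian polynomials increase on the positive reals but not on the whole line.\<close>

lemma cond_number_commuting_mono:
  fixes A B :: "real^'n^'n"
  assumes sym: "transpose A = A" and comm: "A ** B = B ** A"
    and p: "\<And>c v. A *v v = c *\<^sub>R v \<Longrightarrow> B *v v = p c *\<^sub>R v"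
    and mono: "mono_on (eigenvalues A) p"
  shows "cond_number B = p (Max (eigenvalues A)) / p (Min (eigenvalues A))"
proof -
  let ?S = "eigenvalues A"
  have S: "finite ?S" "?S \<noteq> {}"
    using sym by (simp_all add: symmetric_eigenvalues_finite symmetric_eigenvalues_nonempty)
  have "Max (p ` ?S) = p (Max ?S)"
  proof (rule Max_eqI)
    show "finite (p ` ?S)" and "p (Max ?S) \<in> p ` ?S"
      using S Max_in[OF S] by (auto simp del: Max_in)
  next
    fix y
    assume "y \<in> p ` ?S"
    then obtain x where "y = p x" "x \<in> ?S"
      by blast
    then show "y \<le> p (Max ?S)"
      using mono_onD[OF mono] S Max_in[OF S] by simp
  qed
  moreover have "Min (p ` ?S) = p (Min ?S)"
  proof (rule Min_eqI)
    show "finite (p ` ?S)" and "p (Min ?S) \<in> p ` ?S"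
      using S Min_in[OF S] by (auto simp del: Min_in)
  next
    fix y
    assume "y \<in> p ` ?S"
    then obtain x where "y = p x" "x \<in> ?S"
      by blast
    then show "p (Min ?S) \<le> y"
      using mono_onD[OF mono] S Min_in[OF S] by simp
  qed
  moreover have "eigenvalues B = p ` ?S"
    by (rule eigenvalues_commuting_image[OF sym comm p])
  ultimately show ?thesis
    by (simp add: cond_number_def)
qed

lemma positive_definite_eigenvalue_pos:
  fixes A :: "real^'n^'n"
  assumes "positive_definite A" and "c \<in> eigenvalues A"
  shows "0 < c"
proof -
  obtain v where v: "v \<noteq> 0" "A *v v = c *\<^sub>R v"
    using assms(2) by (auto simp: eigenvalues_def)
  then have "0 < c * (v \<bullet> v)"
    using assms(1) by (metis positive_definite_def inner_scaleR_right)
  moreover have "0 < v \<bullet> v"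
    using v by simp
  ultimately show ?thesis
    by (simp add: zero_less_mult_iff)
qed


section \<open>Condition numbers of the two Hessians\<close>

context
  fixes K :: "real^'n^'n" and a reg :: real
  assumes pd: "positive_definite K" and a: "0 < a" and reg: "0 < reg"
begin

lemma transpose_pd: "transpose K = K"
  using pd by (simp add: positive_definite_def)

lemma pd_eigenvalues:
  shows "0 < Min (eigenvalues K)" and "Min (eigenvalues K) \<le> Max (eigenvalues K)"
proof -
  have S: "finite (eigenvalues K)" "eigenvalues K \<noteq> {}"
    using transpose_pd by (simp_all add: symmetric_eigenvalues_finite symmetric_eigenvalues_nonempty)
  then show "0 < Min (eigenvalues K)"
    using positive_definite_eigenvalue_pos[OF pd] by simp
  show "Min (eigenvalues K) \<le> Max (eigenvalues K)"
    using S by simp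
qed

lemma cond_number_regularised:
  "cond_number (a *\<^sub>R K + reg *\<^sub>R mat 1)
    = (a * Max (eigenvalues K) + reg) / (a * Min (eigenvalues K) + reg)"
proof (rule cond_number_commuting_mono[OF transpose_pd])
  show "mono_on (eigenvalues K) (\<lambda>c. a * c + reg)"
    using a by (auto intro!: mono_onI mult_left_mono)
qed (simp_all add: matrix_eq matrix_polynomial_simps power2_eq_square)

text \<open>Here \<open>p t = t * (a * t + reg)\<close>. Both factors are positive and increasing
  for positive \<open>t\<close>, and the quotient of the extreme values splits factor by
  factor.\<close>

lemma cond_number_KuLSIF:
  "cond_number (a *\<^sub>R (K ** K) + reg *\<^sub>R K)
    = cond_number K * cond_number (a *\<^sub>R K + reg *\<^sub>R mat 1)"
proof -
  have "cond_number (a *\<^sub>R (K ** K) + reg *\<^sub>R K) =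
      (Max (eigenvalues K) * (a * Max (eigenvalues K) + reg)) /
      (Min (eigenvalues K) * (a * Min (eigenvalues K) + reg))"
  proof (rule cond_number_commuting_mono[OF transpose_pd])
    show "mono_on (eigenvalues K) (\<lambda>c. c * (a * c + reg))"
    proof (rule mono_onI)
      fix c d
      assume "c \<in> eigenvalues K" and "c \<le> d"
      then have "0 < c"
        using positive_definite_eigenvalue_pos[OF pd] by simp
      have "0 < a * c + reg" and "a * c + reg \<le> a * d + reg"
        using \<open>0 < c\<close> \<open>c \<le> d\<close> a reg by (simp_all add: add_pos_pos)
      then show "c * (a * c + reg) \<le> d * (a * d + reg)"
        using \<open>0 < c\<close> \<open>c \<le> d\<close> by (intro mult_mono) simp_all
    qed
  qed (simp_all add: matrix_eq matrix_polynomial_simps power2_eq_square)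
  then show ?thesis
    unfolding cond_number_regularised by (simp add: cond_number_def[of K])
qed

text \<open>The matrix is \<open>K\<close> times the square of \<open>a K + reg I\<close>, so the
  regularised factor enters \<open>p\<close> squared.\<close>

lemma cond_number_KMM:
  "cond_number (a\<^sup>2 *\<^sub>R (K ** K ** K) + (2 * reg * a) *\<^sub>R (K ** K) + reg\<^sup>2 *\<^sub>R K)
    = cond_number K * (cond_number (a *\<^sub>R K + reg *\<^sub>R mat 1))\<^sup>2"
proof -
  have "cond_number (a\<^sup>2 *\<^sub>R (K ** K ** K) + (2 * reg * a) *\<^sub>R (K ** K) + reg\<^sup>2 *\<^sub>R K) =
      (Max (eigenvalues K) * (a * Max (eigenvalues K) + reg)\<^sup>2) /
      (Min (eigenvalues K) * (a * Min (eigenvalues K) + reg)\<^sup>2)"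
  proof (rule cond_number_commuting_mono[OF transpose_pd])
    show "mono_on (eigenvalues K) (\<lambda>c. c * (a * c + reg)\<^sup>2)"
    proof (rule mono_onI)
      fix c d
      assume "c \<in> eigenvalues K" and "c \<le> d"
      then have "0 < c"
        using positive_definite_eigenvalue_pos[OF pd] by simp
      have "0 < a * c + reg" and "a * c + reg \<le> a * d + reg"
        using \<open>0 < c\<close> \<open>c \<le> d\<close> a reg by (simp_all add: add_pos_pos)
      then show "c * (a * c + reg)\<^sup>2 \<le> d * (a * d + reg)\<^sup>2"
        using \<open>0 < c\<close> \<open>c \<le> d\<close> by (intro mult_mono power_mono) simp_all
    qed
  qed (simp_all add: matrix_eq matrix_polynomial_simps power2_eq_square)
  then show ?thesis
    unfolding cond_number_regularised by (simp add: cond_number_def[of K] power_divide)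
qed

text \<open>The two values differ by one more factor
  \<open>cond_number (a *\<^sub>R K + reg *\<^sub>R mat 1)\<close>, which is at least 1.\<close>

lemma cond_number_KuLSIF_le_KMM:
  "cond_number (a *\<^sub>R (K ** K) + reg *\<^sub>R K)
    \<le> cond_number (a\<^sup>2 *\<^sub>R (K ** K ** K) + (2 * reg * a) *\<^sub>R (K ** K) + reg\<^sup>2 *\<^sub>R K)"
proof -
  have "0 < a * Min (eigenvalues K) + reg"
    using pd_eigenvalues a reg by (intro add_pos_pos mult_pos_pos)
  then have "1 \<le> cond_number (a *\<^sub>R K + reg *\<^sub>R mat 1)"
    using pd_eigenvalues a by (simp add: cond_number_regularised)
  moreover have "0 \<le> cond_number K"
    using pd_eigenvalues by (simp add: cond_number_def)
  ultimately show ?thesis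
    unfolding cond_number_KuLSIF cond_number_KMM
    by (intro mult_left_mono self_le_power) auto
qed

end


section \<open>Hessians of quadratic functions\<close>

lemma transpose_add:
  fixes A B :: "real^'n^'m"
  shows "transpose (A + B) = transpose A + transpose B"
  by (simp add: transpose_def vec_eq_iff)

text \<open>The product rule gives two terms, equal by symmetry, which absorb the factor 1/2. The
  gradient is therefore the affine map \<open>A *v y + b\<close>.\<close>

lemma has_hessian_quadratic:
  fixes A :: "real^'n^'n"
  assumes sym: "transpose A = A"
  shows "has_hessian (\<lambda>\<alpha>. 1 / 2 * (\<alpha> \<bullet> (A *v \<alpha>)) + b \<bullet> \<alpha> + c) A x"
proof -
  have swap: "v \<bullet> (A *v w) = w \<bullet> (A *v v)" for v w
    by (simp add: symmetric_inner_matrix[OF sym, of v] inner_commute)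
  have lin: "((\<lambda>\<alpha>. A *v \<alpha>) has_derivative (\<lambda>h. A *v h)) (at y)" for y
    by (simp add: bounded_linear_imp_has_derivative matrix_vector_mul_bounded_linear)
  have "((\<lambda>\<alpha>. 1 / 2 * (\<alpha> \<bullet> (A *v \<alpha>)) + b \<bullet> \<alpha> + c) has_derivative (\<lambda>h. h \<bullet> (A *v y + b))) (at y)" for y
    by (rule derivative_eq_intros lin refl)+
      (simp add: fun_eq_iff swap[of y] inner_commute[of b] inner_add_right)
  moreover have "((\<lambda>y. A *v y + b) has_derivative (\<lambda>h. A *v h)) (at x)"
    by (rule derivative_eq_intros lin refl)+ simp
  ultimately show ?thesis
    unfolding has_hessian_def gderiv_def by (intro exI[of _ "\<lambda>y. A *v y + b"]) simp
qed


section \<open>Kernel expansions\<close>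

context rkhs
begin

lemma kernel_sum_mem: "finite I \<Longrightarrow> (\<lambda>z. \<Sum>i\<in>I. c i * k z (x i)) \<in> H"
  by (induction rule: finite_induct)
    (simp_all add: zero_mem add_mem scale_mem kernel_mem)

text \<open>The reproducing property extended by linearity; it turns the norms in both objectives
  into finite sums of point values.\<close>

lemma ip_kernel_sum_left:
  assumes f: "f \<in> H" and "finite I"
  shows "ip (\<lambda>z. \<Sum>i\<in>I. c i * k z (x i)) f = (\<Sum>i\<in>I. c i * f (x i))"
  using assms(2)
proof (induction rule: finite_induct)
  case empty
  show ?case
    using ip_scale_left[OF zero_mem f, of 0] by simp
next
  case (insert i I)
  then show ?case
    by (simp add: ip_add_left ip_scale_left scale_mem kernel_mem kernel_sum_mem f reproducing
        ip_commute[OF kernel_mem f])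
qed

lemma ip_nonneg: "f \<in> H \<Longrightarrow> 0 \<le> ip f f"
  using ip_pos[of f] ip_scale_left[OF zero_mem zero_mem, of 0] by (cases "f = (\<lambda>z. 0)") auto

lemma ip_norm_square: "f \<in> H \<Longrightarrow> (ip_norm ip f)\<^sup>2 = ip f f"
  by (simp add: ip_norm_def ip_nonneg)

section \<open>The two objectives as functions of the coefficient vector\<close>

context
  fixes X :: "'n::finite \<Rightarrow> 'z" and Y :: "'m::finite \<Rightarrow> 'z" and reg :: real
  assumes reg: "0 < reg"
begin

lemma w_fun_mem: "w_fun k X Y reg \<alpha> \<in> H"
  using kernel_sum_mem[of UNIV "\<lambda>_. 1" Y]
  unfolding w_fun_def by (intro add_mem scale_mem kernel_sum_mem) simp_all

lemma ip_norm_w_fun: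
  "(ip_norm ip (w_fun k X Y reg \<alpha>))\<^sup>2 =
    (\<Sum>i\<in>UNIV. \<alpha> $ i * w_fun k X Y reg \<alpha> (X i))
      + 1 / (real CARD('m) * reg) * (\<Sum>j\<in>UNIV. w_fun k X Y reg \<alpha> (Y j))"
proof -
  have mem: "(\<lambda>z. \<Sum>i\<in>UNIV. \<alpha> $ i * k z (X i)) \<in> H" "(\<lambda>z. \<Sum>j\<in>UNIV. k z (Y j)) \<in> H"
    using kernel_sum_mem[of UNIV "\<lambda>_. 1" Y] kernel_sum_mem[of UNIV "($) \<alpha>" X] by simp_all
  define w where "w = w_fun k X Y reg \<alpha>"
  have w: "w \<in> H"
    by (simp add: w_def w_fun_mem)
  \<comment> \<open>Only the left argument is expanded; keeping \<open>w\<close> on the right lets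
    the reproducing property evaluate it at the sample points.\<close>
  have "ip w w = ip (\<lambda>z. \<Sum>i\<in>UNIV. \<alpha> $ i * k z (X i)) w
      + 1 / (real CARD('m) * reg) * ip (\<lambda>z. \<Sum>j\<in>UNIV. k z (Y j)) w"
    by (subst (1) w_def, unfold w_fun_def)
      (simp only: ip_add_left[OF mem(1) scale_mem[OF mem(2)] w] ip_scale_left[OF mem(2) w])
  then show ?thesis
    using ip_kernel_sum_left[OF w, of UNIV "\<lambda>_. 1" Y] ip_kernel_sum_left[OF w, of UNIV "($) \<alpha>" X]
    by (simp add: ip_norm_square[OF w] flip: w_def)
qed

text \<open>The \<open>Y\<close>-parts of \<open>Phi_hat\<close> and of \<open>reg * w\<close> cancel.\<close>

lemma Phi_hat_w_fun:
  "Phi_hat k X Y (w_fun k X Y reg \<alpha>) z + reg * w_fun k X Y reg \<alpha> z =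
    (\<Sum>i\<in>UNIV. (1 / real CARD('n) * w_fun k X Y reg \<alpha> (X i) + reg * \<alpha> $ i) * k z (X i))"
proof -
  have "reg * w_fun k X Y reg \<alpha> z = reg * (\<Sum>i\<in>UNIV. \<alpha> $ i * k z (X i))
      + 1 / real CARD('m) * (\<Sum>j\<in>UNIV. k z (Y j))"
    using reg by (simp add: w_fun_def distrib_left)
  then show ?thesis
    by (simp add: Phi_hat_def sum_distrib_left sum.distrib algebra_simps)
qed

text \<open>The contribution of the \<open>Y\<close>-part to the values of \<open>w_fun\<close> at
  the points \<open>X i\<close>; it is constant in \<alpha>.\<close>

definition offset :: "real^'n"
  where "offset = (\<chi> i. 1 / (real CARD('m) * reg) * (\<Sum>j\<in>UNIV. k (X i) (Y j)))"

lemma w_fun_sample: "w_fun k X Y reg \<alpha> (X i) = (gram k X *v \<alpha> + offset) $ i"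
  by (simp add: w_fun_def offset_def gram_def matrix_vector_mult_def mult.commute)

text \<open>The coefficients stay anonymous because an affine term leaves the Hessian
  unchanged.\<close>

lemma sum_w_fun_affine:
  obtains b c where "\<And>\<alpha>. (\<Sum>j\<in>UNIV. w_fun k X Y reg \<alpha> (Y j)) = b \<bullet> \<alpha> + c"
proof
  fix \<alpha>
  have "(\<Sum>j\<in>UNIV. \<Sum>i\<in>UNIV. \<alpha> $ i * k (Y j) (X i)) = (\<chi> i. \<Sum>j\<in>UNIV. k (Y j) (X i)) \<bullet> \<alpha>"
    by (subst sum.swap) (simp add: inner_vec_def sum_distrib_left mult.commute)
  then show "(\<Sum>j\<in>UNIV. w_fun k X Y reg \<alpha> (Y j)) = (\<chi> i. \<Sum>j\<in>UNIV. k (Y j) (X i)) \<bullet> \<alpha>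
      + (\<Sum>j\<in>UNIV. 1 / (real CARD('m) * reg) * (\<Sum>j'\<in>UNIV. k (Y j) (Y j')))"
    by (simp add: w_fun_def sum.distrib)
qed

text \<open>The \<open>Y\<close>-part of the squared norm contributes \<open>1 / (2m)\<close> times
  the sum over \<open>Y\<close>, cancelling half of the term with factor
  \<open>-1 / m\<close>.\<close>

lemma KuLSIF_objective_w_fun:
  "KuLSIF_objective ip X Y reg (w_fun k X Y reg \<alpha>) =
    1 / (2 * real CARD('n)) * ((gram k X *v \<alpha> + offset) \<bullet> (gram k X *v \<alpha> + offset))
      + reg / 2 * (\<alpha> \<bullet> (gram k X *v \<alpha> + offset))
      - 1 / (2 * real CARD('m)) * (\<Sum>j\<in>UNIV. w_fun k X Y reg \<alpha> (Y j))"
proof -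
  have "reg / 2 * (q + 1 / (real CARD('m) * reg) * s) = reg / 2 * q + 1 / (2 * real CARD('m)) * s" for q s
    using reg by (simp add: distrib_left)
  then show ?thesis
    unfolding KuLSIF_objective_def ip_norm_w_fun w_fun_sample
    by (simp add: inner_vec_def power2_eq_square)
qed

text \<open>After the cancellation of the \<open>Y\<close>-parts the residual is a kernel expansion
  over \<open>X\<close> alone, so its squared norm is the Gram form of its coefficient vector, which
  is affine in \<alpha>.\<close>

lemma KMM_objective_w_fun:
  "KMM_objective ip k X Y reg (w_fun k X Y reg \<alpha>) =
    1 / 2 * (((1 / real CARD('n)) *\<^sub>R (gram k X *v \<alpha> + offset) + reg *\<^sub>R \<alpha>) \<bullet>
      (gram k X *v ((1 / real CARD('n)) *\<^sub>R (gram k X *v \<alpha> + offset) + reg *\<^sub>R \<alpha>)))"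
proof -
  define \<beta> where "\<beta> = (1 / real CARD('n)) *\<^sub>R (gram k X *v \<alpha> + offset) + reg *\<^sub>R \<alpha>"
  define f where "f = (\<lambda>z. \<Sum>i\<in>UNIV. \<beta> $ i * k z (X i))"
  have f: "f \<in> H"
    by (simp add: f_def kernel_sum_mem)
  have "(\<lambda>z. Phi_hat k X Y (w_fun k X Y reg \<alpha>) z + reg * w_fun k X Y reg \<alpha> z) = f"
    by (simp add: Phi_hat_w_fun f_def \<beta>_def w_fun_sample)
  moreover have "ip f f = (\<Sum>i\<in>UNIV. \<beta> $ i * f (X i))"
    using ip_kernel_sum_left[OF f, of UNIV "($) \<beta>" X] by (simp flip: f_def)
  moreover have "\<dots> = \<beta> \<bullet> (gram k X *v \<beta>)"
    by (simp add: f_def inner_vec_def gram_def matrix_vector_mult_def mult.commute)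
  ultimately show ?thesis
    by (simp add: KMM_objective_def ip_norm_square[OF f] flip: \<beta>_def)
qed

lemma has_hessian_KuLSIF:
  assumes sym: "transpose (gram k X) = gram k X"
  shows "has_hessian (\<lambda>\<alpha>. KuLSIF_objective ip X Y reg (w_fun k X Y reg \<alpha>))
    ((1 / real CARD('n)) *\<^sub>R (gram k X ** gram k X) + reg *\<^sub>R gram k X) x"
proof -
  define K where "K = gram k X"
  obtain b c where bc: "\<And>\<alpha>. (\<Sum>j\<in>UNIV. w_fun k X Y reg \<alpha> (Y j)) = b \<bullet> \<alpha> + c"
    using sum_w_fun_affine by blast
  define A where "A = (1 / real CARD('n)) *\<^sub>R (K ** K) + reg *\<^sub>R K"
  \<comment> \<open>The linear terms: the cross term of the square, the \<open>offset\<close> part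
    of the norm, and the sum over \<open>Y\<close>.\<close>
  define b' where "b' = (1 / real CARD('n)) *\<^sub>R (K *v offset) + (reg / 2) *\<^sub>R offset
    - (1 / (2 * real CARD('m))) *\<^sub>R b"
  define c' where "c' = 1 / (2 * real CARD('n)) * (offset \<bullet> offset) - c / (2 * real CARD('m))"
  have adj: "(K *v v) \<bullet> w = v \<bullet> (K *v w)" for v w
    using symmetric_inner_matrix[OF sym] by (simp add: K_def)
  \<comment> \<open>Oriented to move \<open>offset\<close> to the left, which brings all linear
    terms to one normal form.\<close>
  have swap: "\<alpha> \<bullet> offset = offset \<bullet> \<alpha>" "\<alpha> \<bullet> (K *v offset) = offset \<bullet> (K *v \<alpha>)" for \<alpha>
    by (rule inner_commute, metis adj inner_commute)
  have quadratic: "KuLSIF_objective ip X Y reg (w_fun k X Y reg \<alpha>) = 1 / 2 * (\<alpha> \<bullet> (A *v \<alpha>)) + b' \<bullet> \<alpha> + c'" for \<alpha>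
    unfolding KuLSIF_objective_w_fun bc K_def[symmetric] A_def b'_def c'_def
    by (simp add: matrix_polynomial_simps inner_add_left inner_add_right inner_diff_left adj swap[of \<alpha>]
        add_divide_distrib diff_divide_distrib)
  have "transpose A = A"
    using sym unfolding A_def K_def
    by (simp add: transpose_add transpose_scalar matrix_transpose_mul)
  from has_hessian_quadratic[OF this, of b' c' x] show ?thesis
    unfolding quadratic by (simp only: A_def K_def)
qed

lemma has_hessian_KMM:
  assumes sym: "transpose (gram k X) = gram k X"
  shows "has_hessian (\<lambda>\<alpha>. KMM_objective ip k X Y reg (w_fun k X Y reg \<alpha>))
    ((1 / (real CARD('n))\<^sup>2) *\<^sub>R (gram k X ** gram k X ** gram k X)
      + (2 * reg / real CARD('n)) *\<^sub>R (gram k X ** gram k X) + reg\<^sup>2 *\<^sub>R gram k X) x"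
proof -
  define K where "K = gram k X"
  define a where "a = 1 / real CARD('n)"
  define A where "A = a\<^sup>2 *\<^sub>R (K ** K ** K) + (2 * reg * a) *\<^sub>R (K ** K) + reg\<^sup>2 *\<^sub>R K"
  \<comment> \<open>With \<beta> = \<open>(a K + reg I)\<close> \<alpha> + \<open>a offset\<close>,
    these are the linear and constant parts of half the form \<beta> \<bullet> \<open>K\<close>
    \<beta>.\<close>
  define b where "b = a\<^sup>2 *\<^sub>R (K *v (K *v offset)) + (reg * a) *\<^sub>R (K *v offset)"
  define c where "c = 1 / 2 * (a\<^sup>2 * (offset \<bullet> (K *v offset)))"
  have adj: "(K *v v) \<bullet> w = v \<bullet> (K *v w)" for v w
    using symmetric_inner_matrix[OF sym] by (simp add: K_def)
  have swap: "\<alpha> \<bullet> (K *v offset) = offset \<bullet> (K *v \<alpha>)"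
    "\<alpha> \<bullet> (K *v (K *v offset)) = offset \<bullet> (K *v (K *v \<alpha>))" for \<alpha>
    by (metis adj inner_commute)+
  have quadratic: "KMM_objective ip k X Y reg (w_fun k X Y reg \<alpha>) = 1 / 2 * (\<alpha> \<bullet> (A *v \<alpha>)) + b \<bullet> \<alpha> + c" for \<alpha>
    unfolding KMM_objective_w_fun K_def[symmetric] a_def[symmetric] A_def b_def c_def
    by (simp add: matrix_polynomial_simps inner_add_left inner_add_right adj swap[of \<alpha>] power2_eq_square)
  have "transpose A = A"
    using sym unfolding A_def K_def
    by (simp add: transpose_add transpose_scalar matrix_transpose_mul matrix_mul_assoc)
  from has_hessian_quadratic[OF this, of b c x] show ?thesis
    unfolding quadratic by (simp only: A_def K_def a_def power_divide power_one mult_1_right times_divide_eq_right)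
qed

end

end

theorem mainTheorem1:
  fixes H :: "('z \<Rightarrow> real) set"
    and ip :: "('z \<Rightarrow> real) \<Rightarrow> ('z \<Rightarrow> real) \<Rightarrow> real"
    and k :: "'z \<Rightarrow> 'z \<Rightarrow> real"
    and X :: "'n::finite \<Rightarrow> 'z"
    and Y :: "'m::finite \<Rightarrow> 'z"
    and reg :: real
  defines "K \<equiv> gram k X"
    and "n \<equiv> real CARD('n)"
    and "J_KuLSIF \<equiv> (\<lambda>\<alpha>. KuLSIF_objective ip X Y reg (w_fun k X Y reg \<alpha>))"
    and "J_KMM \<equiv> (\<lambda>\<alpha>. KMM_objective ip k X Y reg (w_fun k X Y reg \<alpha>))"
  assumes "rkhs H ip k"
    and "0 < reg"
    and "positive_definite K"
  shows "\<forall>\<alpha>.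
    has_hessian J_KuLSIF ((1 / n) *\<^sub>R (K ** K) + reg *\<^sub>R K) \<alpha> \<and>
    has_hessian J_KMM
      ((1 / n\<^sup>2) *\<^sub>R (K ** K ** K) + (2 * reg / n) *\<^sub>R (K ** K) + reg\<^sup>2 *\<^sub>R K) \<alpha> \<and>
    cond_number (hessian J_KuLSIF \<alpha>) =
      cond_number K * cond_number ((1 / n) *\<^sub>R K + reg *\<^sub>R mat 1) \<and>
    cond_number (hessian J_KMM \<alpha>) =
      cond_number K * (cond_number ((1 / n) *\<^sub>R K + reg *\<^sub>R mat 1))\<^sup>2 \<and>
    cond_number (hessian J_KuLSIF \<alpha>) \<le> cond_number (hessian J_KMM \<alpha>)"
proof
  fix \<alpha>
  interpret rkhs H ip k
    by fact
  have sym: "transpose K = K"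
    using \<open>positive_definite K\<close> by (simp add: positive_definite_def)
  have hess: "has_hessian J_KuLSIF ((1 / n) *\<^sub>R (K ** K) + reg *\<^sub>R K) \<alpha>"
    "has_hessian J_KMM
      ((1 / n\<^sup>2) *\<^sub>R (K ** K ** K) + (2 * reg / n) *\<^sub>R (K ** K) + reg\<^sup>2 *\<^sub>R K) \<alpha>"
    using sym \<open>0 < reg\<close> unfolding J_KuLSIF_def J_KMM_def K_def n_def
    by (simp_all add: has_hessian_KuLSIF has_hessian_KMM)
  have n: "0 < 1 / n"
    by (simp add: n_def)
  \<comment> \<open>Instances with \<open>a = 1 / n\<close>; \<open>power_divide\<close> below
    reconciles \<open>(1 / n)\<^sup>2\<close> with \<open>1 / n\<^sup>2\<close>.\<close>
  note cond = cond_number_KuLSIF[OF \<open>positive_definite K\<close> n \<open>0 < reg\<close>]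
    cond_number_KMM[OF \<open>positive_definite K\<close> n \<open>0 < reg\<close>]
    cond_number_KuLSIF_le_KMM[OF \<open>positive_definite K\<close> n \<open>0 < reg\<close>]
  show "has_hessian J_KuLSIF ((1 / n) *\<^sub>R (K ** K) + reg *\<^sub>R K) \<alpha> \<and>
    has_hessian J_KMM
      ((1 / n\<^sup>2) *\<^sub>R (K ** K ** K) + (2 * reg / n) *\<^sub>R (K ** K) + reg\<^sup>2 *\<^sub>R K) \<alpha> \<and>
    cond_number (hessian J_KuLSIF \<alpha>) =
      cond_number K * cond_number ((1 / n) *\<^sub>R K + reg *\<^sub>R mat 1) \<and>
    cond_number (hessian J_KMM \<alpha>) =
      cond_number K * (cond_number ((1 / n) *\<^sub>R K + reg *\<^sub>R mat 1))\<^sup>2 \<and>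
    cond_number (hessian J_KuLSIF \<alpha>) \<le> cond_number (hessian J_KMM \<alpha>)"
    using hess cond unfolding hess[THEN hessian_eqI] by (simp add: power_divide)
qed

end
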